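(* Let $D(x)=1+2x-12x^2-216x^3$. Define integer sequences $(a_n),(b_n),(c_n)$ by the power series expansions about $x=0$ and rational sequences $(\alpha_n),(\beta_n),(\gamma_n)$ by the expansions about $x=\infty$ (in powers of $1/x$): \[ \frac{2+22x+60x^2}{D(x)}=\sum_{n\ge0}a_nx^n=\sum_{n\ge1}\alpha_{n-1}x^{-n}, \] \[ \frac{1-13x-6x^2}{D(x)}=\sum_{n\ge0}b_nx^n=\sum_{n\ge1}\beta_{n-1}x^{-n}, \] \[ \frac{1+11x-54x^2}{D(x)}=\sum_{n\ge0}c_nx^n=\sum_{n\ge1}\gamma_{n-1}x^{-n}. \] Then for all $n\ge0$, \[ a_n^3+b_n^3=c_n^3+(2\cdot 6^n)^3\quad\text{and}\quad \alpha_n^3+\beta_n^3=\gamma_n^3-\delta_n^3,\ \text{ where } \delta_n=2/6^{n+1}. \] *)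

theory Defs
  imports "HOL-Computational_Algebra.Computational_Algebra"
begin

text \<open>
  The rational functions are written polymorphically so that the same expression can be expanded
  about $x = 0$, by taking \<^term>\<open>fps_X\<close> for $x$, and about $x = \infty$, by taking
  \<^term>\<open>fls_X_inv\<close> for $x$ in the field of formal Laurent series in $1/x$; the variable
  \<^term>\<open>fls_X\<close> of that field then stands for $1/x$.
\<close>

definition den :: "'a::comm_ring_1 \<Rightarrow> 'a" where
  "den x = 1 + 2 * x - 12 * x ^ 2 - 216 * x ^ 3"

definition ratA :: "'a::{comm_ring_1,inverse} \<Rightarrow> 'a" where
  "ratA x = (2 + 22 * x + 60 * x ^ 2) / den x"

definition ratB :: "'a::{comm_ring_1,inverse} \<Rightarrow> 'a" where
  "ratB x = (1 - 13 * x - 6 * x ^ 2) / den x"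

definition ratC :: "'a::{comm_ring_1,inverse} \<Rightarrow> 'a" where
  "ratC x = (1 + 11 * x - 54 * x ^ 2) / den x"

definition seq_a :: "nat \<Rightarrow> rat" where "seq_a n = fps_nth (ratA fps_X) n"
definition seq_b :: "nat \<Rightarrow> rat" where "seq_b n = fps_nth (ratB fps_X) n"
definition seq_c :: "nat \<Rightarrow> rat" where "seq_c n = fps_nth (ratC fps_X) n"

text \<open>The coefficient of $x^{-(n+1)}$ in the expansion about $x = \infty$.\<close>

definition seq_alpha :: "nat \<Rightarrow> rat" where "seq_alpha n = fls_nth (ratA fls_X_inv) (int n + 1)"
definition seq_beta :: "nat \<Rightarrow> rat" where "seq_beta n = fls_nth (ratB fls_X_inv) (int n + 1)"
definition seq_gamma :: "nat \<Rightarrow> rat" where "seq_gamma n = fls_nth (ratC fls_X_inv) (int n + 1)"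

definition seq_delta :: "nat \<Rightarrow> rat" where "seq_delta n = 2 / 6 ^ (n + 1)"

text \<open>The series $\sum_{n \ge 1} s_{n-1} x^{-n}$.\<close>

definition series_at_infinity :: "(nat \<Rightarrow> rat) \<Rightarrow> rat fls" where
  "series_at_infinity s = fps_to_fls (Abs_fps (\<lambda>n. if n = 0 then 0 else s (n - 1)))"

end

theory Submission
  imports Defs
begin

text \<open>
  Since $D(x) = (1 - 6x)(1 + 8x + 36x^2)$, each of the sequences is a combination of $z = 6^n$,
  $x = l_{n+1}$ and $y = l_n$, where $l$ is the Lucas sequence with characteristic polynomial
  $t^2 + 8t + 36$. The norm form gives $x^2 + 8xy + 36y^2 = z^2$, and on this cone the cubic form
  $a^3 + b^3 - c^3 - (2z)^3$ vanishes. The expansions at infinity are, up to sign, the same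
  sequences at negative indices, where $l_{-n} = -l_n / 36^n$.
\<close>

fun luc :: "nat \<Rightarrow> rat" where
  "luc 0 = 0"
| "luc (Suc 0) = 1"
| "luc (Suc (Suc n)) = - 8 * luc (Suc n) - 36 * luc n"

text \<open>If t1, t2 are the roots of t^2 + 8t + 36, the form is (x - t1 y)(x - t2 y), and
  \<open>luc (Suc n) - t1 * luc n\<close> = t2^n; the product is (t1 t2)^n. In the induction, one
  step of the recurrence multiplies the form by 36.\<close>

lemma luc_norm: "luc (Suc n) ^ 2 + 8 * luc (Suc n) * luc n + 36 * luc n ^ 2 = 36 ^ n"
proof (induction n)
  case (Suc n)
  have "luc (Suc (Suc n)) ^ 2 + 8 * luc (Suc (Suc n)) * luc (Suc n) + 36 * luc (Suc n) ^ 2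
      = 36 * (luc (Suc n) ^ 2 + 8 * luc (Suc n) * luc n + 36 * luc n ^ 2)"
    by (simp add: algebra_simps power2_eq_square)
  then show ?case using Suc.IH by simp
qed simp

lemma cubic_form_vanishes:
  fixes x y z :: rat
  assumes "x ^ 2 + 8 * x * y + 36 * y ^ 2 = z ^ 2"
  shows "((11 * z - x + 16 * y) / 5) ^ 3 + ((- 2 * z + 7 * x - 7 * y) / 5) ^ 3
       = ((2 * z + 3 * x + 57 * y) / 5) ^ 3 + (2 * z) ^ 3"
proof -
  \<comment> \<open>Clearing the denominator 5 turns \<open>(2 * z) ^ 3\<close> into
    \<open>1000 * z ^ 3\<close>. The cubic form is then the quadratic form of the hypothesis times a
    linear factor.\<close>
  have "(11 * z - x + 16 * y) ^ 3 + (- 2 * z + 7 * x - 7 * y) ^ 3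
      - (2 * z + 3 * x + 57 * y) ^ 3 - 1000 * z ^ 3
      = 315 * (x - z - 16 * y) * (x ^ 2 + 8 * x * y + 36 * y ^ 2 - z ^ 2)"
    by algebra
  then show ?thesis using assms by (simp add: power_divide power_mult_distrib)
qed

text \<open>\<open>p\<close>, \<open>q\<close>, \<open>r\<close> are the coefficients of z, x, y in
  one of the linear forms of \<open>cubic_form_vanishes\<close>.\<close>

definition comb_zero :: "rat \<Rightarrow> rat \<Rightarrow> rat \<Rightarrow> nat \<Rightarrow> rat" where
  "comb_zero p q r n = (p * 6 ^ n + q * luc (Suc n) + r * luc n) / 5"

text \<open>Minus the \<open>comb_zero\<close> formula continued to index -(n+1): there z =
  6^(-(n+1)), and x and y are the Lucas terms at -n and -(n+1).\<close>

definition comb_infinity :: "rat \<Rightarrow> rat \<Rightarrow> rat \<Rightarrow> nat \<Rightarrow> rat" where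
  "comb_infinity p q r n =
     - (p * (1 / 6 ^ Suc n) + q * (- luc n / 36 ^ n) + r * (- luc (Suc n) / 36 ^ Suc n)) / 5"

text \<open>The characteristic polynomial t^3 + 2t^2 - 12t - 216 = (t - 6)(t^2 + 8t + 36)
  annihilates both the power of 6 and the Lucas terms.\<close>

lemma comb_zero_rec:
  "comb_zero p q r (n + 3) =
     - 2 * comb_zero p q r (n + 2) + 12 * comb_zero p q r (n + 1) + 216 * comb_zero p q r n"
  by (simp add: comb_zero_def numeral_2_eq_2 numeral_3_eq_3 field_simps)

text \<open>The recurrence of \<open>comb_zero\<close> read backwards, since the index now runs
  towards minus infinity.\<close>

lemma comb_infinity_rec:
  "216 * comb_infinity p q r (n + 3) =
     - 12 * comb_infinity p q r (n + 2) + 2 * comb_infinity p q r (n + 1) + comb_infinity p q r n"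
  by (simp add: comb_infinity_def numeral_2_eq_2 numeral_3_eq_3 field_simps)

lemma pow_36: "(36 :: rat) ^ n = (6 ^ n) ^ 2"
proof -
  have "(36 :: rat) ^ n = (6 ^ 2) ^ n" by simp
  then show ?thesis by (simp only: power_commutes power_mult[symmetric] mult.commute)
qed

lemma cubic_identity_zero:
  "comb_zero 11 (- 1) 16 n ^ 3 + comb_zero (- 2) 7 (- 7) n ^ 3
     = comb_zero 2 3 57 n ^ 3 + (2 * 6 ^ n) ^ 3"
proof -
  have "luc (Suc n) ^ 2 + 8 * luc (Suc n) * luc n + 36 * luc n ^ 2 = (6 ^ n) ^ 2"
    by (simp add: luc_norm pow_36)
  from cubic_form_vanishes[OF this] show ?thesis by (simp add: comb_zero_def)
qed

lemma cubic_identity_infinity: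
  "comb_infinity 11 (- 1) 16 n ^ 3 + comb_infinity (- 2) 7 (- 7) n ^ 3
     = comb_infinity 2 3 57 n ^ 3 - (2 / 6 ^ (n + 1)) ^ 3"
proof -
  define x where "x = - luc n / 36 ^ n"
  define y where "y = - luc (Suc n) / 36 ^ Suc n"
  define z where "z = (1 / 6 ^ Suc n :: rat)"
  \<comment> \<open>Over the common denominator the squares of \<open>luc n\<close> and
    \<open>luc (Suc n)\<close> trade coefficients, which gives the form of \<open>luc_norm\<close>
    again.\<close>
  have "x ^ 2 + 8 * x * y + 36 * y ^ 2
      = (luc (Suc n) ^ 2 + 8 * luc (Suc n) * luc n + 36 * luc n ^ 2) / (36 * (36 ^ n) ^ 2)"
    by (simp add: x_def y_def field_simps power2_eq_square)
  also have "\<dots> = z ^ 2"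
    unfolding luc_norm z_def
    by (simp add: power_divide power_mult_distrib pow_36 field_simps flip: power_mult power_add)
  finally have "x ^ 2 + 8 * x * y + 36 * y ^ 2 = z ^ 2" .
  from cubic_form_vanishes[OF this]
  \<comment> \<open>Negating the three linear forms but not \<open>2 * z\<close> puts a minus sign
    before the last cube; this is the sign of \<delta> in the theorem.\<close>
  have "(- ((11 * z - x + 16 * y) / 5)) ^ 3 + (- ((- 2 * z + 7 * x - 7 * y) / 5)) ^ 3
       = (- ((2 * z + 3 * x + 57 * y) / 5)) ^ 3 - (2 * z) ^ 3"
    by (simp add: power3_eq_cube)
  moreover have "2 / 6 ^ (n + 1) = 2 * z"
    by (simp add: z_def)
  moreover have "comb_infinity p q r n = - ((p * z + q * x + r * y) / 5)" for p q r
    by (simp only: comb_infinity_def x_def y_def z_def minus_divide_left)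
  ultimately show ?thesis by simp
qed

text \<open>Comparison of coefficients: degrees 0 to 2 give the initial conditions, and all higher
  ones vanish by the recurrence. \<open>k0\<close> is arbitrary because it is 1 at zero but -216 at
  infinity.\<close>

lemma fps_mult_cubic_recurrence:
  fixes f :: "nat \<Rightarrow> 'a :: comm_ring_1"
  assumes "k0 * f 0 = c0" "k0 * f 1 + k1 * f 0 = c1" "k0 * f 2 + k1 * f 1 + k2 * f 0 = c2"
    and "\<And>n. k0 * f (n + 3) + k1 * f (n + 2) + k2 * f (n + 1) + k3 * f n = 0"
  shows "(fps_const k0 + fps_const k1 * fps_X + fps_const k2 * fps_X ^ 2
           + fps_const k3 * fps_X ^ 3) * Abs_fps f
       = fps_const c0 + fps_const c1 * fps_X + fps_const c2 * fps_X ^ 2"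
proof (rule fps_ext)
  fix n :: nat
  consider "n = 0" | "n = 1" | "n = 2" | m where "n = m + 3"
  proof (cases "n < 3")
    case True
    then have "n = 0 \<or> n = 1 \<or> n = 2" by auto
    with that show ?thesis by blast
  next
    case False
    then have "n = (n - 3) + 3" by simp
    with that show ?thesis by blast
  qed
  then show "fps_nth ((fps_const k0 + fps_const k1 * fps_X + fps_const k2 * fps_X ^ 2
           + fps_const k3 * fps_X ^ 3) * Abs_fps f) n
       = fps_nth (fps_const c0 + fps_const c1 * fps_X + fps_const c2 * fps_X ^ 2) n"
    using assms(1-3) assms(4)
    by cases
       (simp_all add: distrib_right mult.assoc fps_X_power_mult_nth fps_X_power_nth
          numeral_2_eq_2 numeral_3_eq_3 eval_nat_numeral)
qed

lemma expansion_zero: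
  fixes f :: "nat \<Rightarrow> rat" and c0 c1 c2 :: int
  assumes "f 0 = of_int c0" "f 1 + 2 * f 0 = of_int c1" "f 2 + 2 * f 1 - 12 * f 0 = of_int c2"
    and "\<And>n. f (n + 3) = - 2 * f (n + 2) + 12 * f (n + 1) + 216 * f n"
  shows "(of_int c0 + of_int c1 * fps_X + of_int c2 * fps_X ^ 2) / den fps_X = Abs_fps f"
proof -
  have "(fps_const 1 + fps_const 2 * fps_X + fps_const (- 12) * fps_X ^ 2
           + fps_const (- 216) * fps_X ^ 3) * Abs_fps f
       = fps_const (of_int c0) + fps_const (of_int c1) * fps_X + fps_const (of_int c2) * fps_X ^ 2"
    by (rule fps_mult_cubic_recurrence) (use assms in auto)
  then have eq: "den fps_X * Abs_fps f = of_int c0 + of_int c1 * fps_X + of_int c2 * fps_X ^ 2"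
    by (simp add: den_def fps_of_int numeral_fps_const flip: fps_const_neg)
  have "fps_nth (den fps_X :: rat fps) 0 \<noteq> 0"
    by (simp add: den_def)
  then have "den fps_X \<noteq> (0 :: rat fps)" by force
  then show ?thesis by (simp flip: eq)
qed

text \<open>With X = 1/x, multiplying the numerator by X^2 and the denominator by X^3 makes both
  polynomials in X with reversed coefficients. The remaining factor X shifts the series to start at
  1/x.\<close>

lemma expansion_infinity:
  fixes f :: "nat \<Rightarrow> rat" and c0 c1 c2 :: int
  assumes "- 216 * f 0 = of_int c2" "- 216 * f 1 - 12 * f 0 = of_int c1"
    and "- 216 * f 2 - 12 * f 1 + 2 * f 0 = of_int c0"
    and "\<And>n. 216 * f (n + 3) = - 12 * f (n + 2) + 2 * f (n + 1) + f n"
  shows "(of_int c0 + of_int c1 * fls_X_inv + of_int c2 * fls_X_inv ^ 2) / den fls_X_inv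
       = fps_to_fls (fps_X * Abs_fps f)"
proof -
  define X where "X = (fls_X :: rat fls)"
  define G where "G = fps_to_fls (Abs_fps f)"
  have "(fps_const (- 216) + fps_const (- 12) * fps_X + fps_const 2 * fps_X ^ 2
           + fps_const 1 * fps_X ^ 3) * Abs_fps f
       = fps_const (of_int c2) + fps_const (of_int c1) * fps_X + fps_const (of_int c0) * fps_X ^ 2"
    by (rule fps_mult_cubic_recurrence) (use assms in auto)
  then have "(- 216 - 12 * fps_X + 2 * fps_X ^ 2 + fps_X ^ 3) * Abs_fps f
      = of_int c2 + of_int c1 * fps_X + of_int c0 * fps_X ^ 2"
    by (simp add: fps_of_int numeral_fps_const flip: fps_const_neg)
  from arg_cong[OF this, of fps_to_fls]
  have eq: "(- 216 - 12 * X + 2 * X ^ 2 + X ^ 3) * G = of_int c2 + of_int c1 * X + of_int c0 * X ^ 2"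
    by (simp add: X_def G_def fls_times_fps_to_fls fps_to_fls_power)
  have X0: "X \<noteq> 0" by (simp add: X_def)
  have inv: "fls_X_inv = 1 / X"
    by (simp add: X_def fls_X_inv_conv_shift_1 fls_inverse_X field_simps)
  have den: "den fls_X_inv = (- 216 - 12 * X + 2 * X ^ 2 + X ^ 3) / X ^ 3"
    using X0 by (simp add: den_def inv field_simps power2_eq_square power3_eq_cube)
  \<comment> \<open>The nonzero constant term shows that the reversed denominator may be divided
    by.\<close>
  have "fps_nth (- 216 - 12 * fps_X + 2 * fps_X ^ 2 + fps_X ^ 3 :: rat fps) 0 \<noteq> 0"
    by simp
  then have "- 216 - 12 * fps_X + 2 * fps_X ^ 2 + fps_X ^ 3 \<noteq> (0 :: rat fps)"
    by force
  then have "fps_to_fls (- 216 - 12 * fps_X + 2 * fps_X ^ 2 + fps_X ^ 3 :: rat fps) \<noteq> 0"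
    by (simp only: fps_to_fls_eq_0_iff not_False_eq_True)
  then have "- 216 - 12 * X + 2 * X ^ 2 + X ^ 3 \<noteq> 0"
    by (simp add: X_def fls_times_fps_to_fls fps_to_fls_power)
  moreover have "of_int c0 + of_int c1 * fls_X_inv + of_int c2 * fls_X_inv ^ 2
      = (of_int c2 + of_int c1 * X + of_int c0 * X ^ 2) / X ^ 2"
    using X0 by (simp add: inv field_simps power2_eq_square)
  ultimately show ?thesis
    using X0 unfolding den eq[symmetric]
    by (simp add: fls_times_fps_to_fls flip: X_def G_def)
       (simp add: power2_eq_square power3_eq_cube)
qed

lemma comb_zero_initial:
  "comb_zero p q r 0 = (p + q) / 5"
  "comb_zero p q r 1 = (6 * p - 8 * q + r) / 5"
  "comb_zero p q r 2 = (36 * p + 28 * q - 8 * r) / 5"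
  by (simp_all add: comb_zero_def numeral_2_eq_2)

lemma comb_infinity_initial:
  "comb_infinity p q r 0 = (- 6 * p + r) / 180"
  "comb_infinity p q r 1 = (- 36 * p + 36 * q - 8 * r) / 6480"
  "comb_infinity p q r 2 = (- 216 * p - 288 * q + 28 * r) / 233280"
  by (simp_all add: comb_infinity_def numeral_2_eq_2 field_simps)

text \<open>The triple solves \<open>comb_zero_initial\<close> for the first coefficients 2, 18, 48
  of the expansion; the triples for \<open>ratB\<close> and \<open>ratC\<close> arise
  likewise.\<close>

lemma ratA_zero: "ratA fps_X = Abs_fps (comb_zero 11 (- 1) 16)"
  using expansion_zero[of "comb_zero 11 (- 1) 16" 2 22 60]
  by (simp add: ratA_def comb_zero_rec comb_zero_initial[unfolded One_nat_def])

lemma ratB_zero: "ratB fps_X = Abs_fps (comb_zero (- 2) 7 (- 7))"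
  using expansion_zero[of "comb_zero (- 2) 7 (- 7)" 1 "- 13" "- 6"]
  by (simp add: ratB_def comb_zero_rec comb_zero_initial[unfolded One_nat_def])

lemma ratC_zero: "ratC fps_X = Abs_fps (comb_zero 2 3 57)"
  using expansion_zero[of "comb_zero 2 3 57" 1 11 "- 54"]
  by (simp add: ratC_def comb_zero_rec comb_zero_initial[unfolded One_nat_def])

lemma ratA_infinity: "ratA fls_X_inv = fps_to_fls (fps_X * Abs_fps (comb_infinity 11 (- 1) 16))"
  \<comment> \<open>The numerator is listed from \<open>c2\<close> down to \<open>c0\<close>, the
    order in which these variables occur in \<open>expansion_infinity\<close>.\<close>
  using expansion_infinity[of "comb_infinity 11 (- 1) 16" 60 22 2]
  by (simp add: ratA_def comb_infinity_rec comb_infinity_initial[unfolded One_nat_def])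

lemma ratB_infinity: "ratB fls_X_inv = fps_to_fls (fps_X * Abs_fps (comb_infinity (- 2) 7 (- 7)))"
  using expansion_infinity[of "comb_infinity (- 2) 7 (- 7)" "- 6" "- 13" 1]
  by (simp add: ratB_def comb_infinity_rec comb_infinity_initial[unfolded One_nat_def])

lemma ratC_infinity: "ratC fls_X_inv = fps_to_fls (fps_X * Abs_fps (comb_infinity 2 3 57))"
  using expansion_infinity[of "comb_infinity 2 3 57" "- 54" 11 1]
  by (simp add: ratC_def comb_infinity_rec comb_infinity_initial[unfolded One_nat_def])

lemma series_at_infinity_eq: "series_at_infinity f = fps_to_fls (fps_X * Abs_fps f)"
  unfolding series_at_infinity_def by (intro arg_cong[where f = fps_to_fls] fps_ext) simp

lemma seq_closed_forms:
  "seq_a = comb_zero 11 (- 1) 16" "seq_alpha = comb_infinity 11 (- 1) 16"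
  "seq_b = comb_zero (- 2) 7 (- 7)" "seq_beta = comb_infinity (- 2) 7 (- 7)"
  "seq_c = comb_zero 2 3 57" "seq_gamma = comb_infinity 2 3 57"
  by (simp_all add: fun_eq_iff seq_a_def seq_b_def seq_c_def seq_alpha_def seq_beta_def
      seq_gamma_def ratA_zero ratB_zero ratC_zero ratA_infinity ratB_infinity ratC_infinity
      nat_add_distrib)

text \<open>The division by 5 hides integrality, but the recurrence is monic with integer
  coefficients, so three consecutive integral values propagate.\<close>

lemma comb_zero_Ints:
  assumes "comb_zero p q r 0 \<in> \<int>" "comb_zero p q r 1 \<in> \<int>" "comb_zero p q r 2 \<in> \<int>"
  shows "comb_zero p q r n \<in> \<int>"
proof -
  have "comb_zero p q r n \<in> \<int> \<and> comb_zero p q r (n + 1) \<in> \<int> \<and> comb_zero p q r (n + 2) \<in> \<int>"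
  proof (induction n)
    case (Suc n)
    then show ?case
      using comb_zero_rec[of p q r n] by (simp add: eval_nat_numeral)
  qed (use assms in \<open>simp add: numeral_2_eq_2\<close>)
  then show ?thesis ..
qed

theorem theorem2p5:
  "(ratA fps_X = Abs_fps seq_a \<and> ratA fls_X_inv = series_at_infinity seq_alpha) \<and>
   (ratB fps_X = Abs_fps seq_b \<and> ratB fls_X_inv = series_at_infinity seq_beta) \<and>
   (ratC fps_X = Abs_fps seq_c \<and> ratC fls_X_inv = series_at_infinity seq_gamma) \<and>
   (\<forall>n. seq_a n \<in> \<int> \<and> seq_b n \<in> \<int> \<and> seq_c n \<in> \<int>) \<and>
   (\<forall>n. seq_a n ^ 3 + seq_b n ^ 3 = seq_c n ^ 3 + (2 * 6 ^ n) ^ 3 \<and>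
        seq_alpha n ^ 3 + seq_beta n ^ 3 = seq_gamma n ^ 3 - seq_delta n ^ 3)"
proof (intro conjI allI)
  fix n
  show "seq_a n \<in> \<int>" "seq_b n \<in> \<int>" "seq_c n \<in> \<int>"
    unfolding seq_closed_forms
    by (rule comb_zero_Ints; simp add: comb_zero_initial[unfolded One_nat_def])+
  show "seq_a n ^ 3 + seq_b n ^ 3 = seq_c n ^ 3 + (2 * 6 ^ n) ^ 3"
    unfolding seq_closed_forms by (rule cubic_identity_zero)
  show "seq_alpha n ^ 3 + seq_beta n ^ 3 = seq_gamma n ^ 3 - seq_delta n ^ 3"
    unfolding seq_closed_forms seq_delta_def by (rule cubic_identity_infinity)
qed (simp_all add: seq_closed_forms series_at_infinity_eq ratA_zero ratB_zero ratC_zero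
      ratA_infinity ratB_infinity ratC_infinity)

end
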